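(* Let $\mathcal H^1\subset\mathcal B\subset\mathcal H^0$, $L=L_1+L_2$, $N$, $E$, $J$, $\overline w$, $I_n$, $\psi_j$, $s_j$, $\phi_j$, $r_j$, $G$, $L_{\mathrm{res}}$, $L_{\mathrm{ap}}$ and the constants $K_0,K_1,K_2,K_3,\delta_1,\gamma_1,\gamma_2,\varepsilon_1,\varepsilon_2$ be as described in the context and satisfy all the assumptions (A), (B), (C), (D) there, for some $n$. Suppose $$K_1-K_0K_2\delta_1-K_0\gamma_1\varepsilon_1>0$$ and $$M_4:=(K_1-K_0K_2\delta_1-K_0\gamma_1\varepsilon_1)^2-4\varepsilon_2K_0K_3(1+\gamma_1\gamma_2)^2\ge0.$$ Then the system $$L_1w_1+L_{\mathrm{res}}w_1=-E-N(w_1+w_2),\qquad Lw_2=-L_{\mathrm{ap}}w_1,\qquad w_2=Gw_1,$$ has a solution $w_1\in\mathcal H^1$ with $$\|w_1\|_{\mathcal H^1}\le x^w:=\frac{K_1-K_0K_2\delta_1-K_0\gamma_1\varepsilon_1-\sqrt{M_4}}{2K_3(1+\gamma_1\gamma_2)^2}.$$ Consequently, there exists a solution $\widetilde w$ of $J(\widetilde w)=0$ such that $\|\overline w-\widetilde w\|_{\mathcal H^1}\le(1+\gamma_1\gamma_2)x^w$.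
   Context: Setting: one wants to solve $J(\widetilde w)=0$ near an approximate solution $\overline w$ with $J(\overline w)=E$. Expanding, $J(\overline w+w)=Lw+N(w)+E$ with $L$ linear and $N$ nonlinear. All equations are understood weakly, i.e. paired via $\langle\cdot,\cdot\rangle_{\mathcal H^0}$ (or its extension to a duality pairing) with all elements of $\mathcal H^1$. (A) Linear part. $\mathcal H^0$ is a Hilbert space; $\mathcal H^1\subset\mathcal B\subset\mathcal H^0$ are dense subspaces with stronger norms $\|\cdot\|_{\mathcal H^1}$, $\|\cdot\|_{\mathcal B}$ ($\mathcal H^1$ a Hilbert space, $\mathcal B$ a Banach space); the embedding $\mathcal H^1\to\mathcal B$ is compact; $\|f\|_{\mathcal H^0}\le K_0\|f\|_{\mathcal H^1}$ and $\|f\|_{\mathcal H^0}\lesssim\|f\|_{\mathcal B}$ for all $f\in\mathcal H^1$, with $K_0>0$. $L=L_1+L_2$, where, for constants $K_1,K_2>0$: $\langle L_1f,f\rangle_{\mathcal H^0}\ge K_1\|f\|_{\mathcal H^1}^2$ and $|\langle L_1f,g\rangle_{\mathcal H^0}|\lesssim\|f\|_{\mathcal H^1}\|g\|_{\mathcal H^1}$ for $f,g\in\mathcal H^1$ ($L_1$ is understood through this bilinear form), and $\|L_2f\|_{\mathcal H^0}\le K_2\|f\|_{\mathcal H^0}$ for $f\in\mathcal H^0$. (B) Finite-rank approximation. $I_n$ is a linear operator of finite rank $n$ with $\|f-I_nf\|_{\mathcal H^0}\le\delta_1\|f\|_{\mathcal H^1}$ for all $f\in\mathcal H^1$, where $\delta_1=\delta_1(n)$;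 $\psi_1,\dots,\psi_n$ is a basis of its image and $I_nf=\sum_{j=1}^ns_j(f)\psi_j$. The elements $\phi_1,\dots,\phi_n\in\mathcal H^1$ and residuals $r_1,\dots,r_n\in\mathcal H^0$ satisfy $L\phi_i=-L_2\psi_i+r_i$. With $S(f)=(s_1(f),\dots,s_n(f))$, $|S(f)|$ its Euclidean norm, $\|R\|_{\mathcal H^0}=(\sum_j\|r_j\|_{\mathcal H^0}^2)^{1/2}$ and $\|\Phi\|_{\mathcal H^1}=(\sum_j\|\phi_j\|_{\mathcal H^1}^2)^{1/2}$, assume $\|R\|_{\mathcal H^0}\le\varepsilon_1$, $|S(f)|\lesssim\|f\|_{\mathcal H^0}$, $|S(f)|\le\gamma_1\|f\|_{\mathcal H^1}$, and $\|\Phi\|_{\mathcal H^1}\le\gamma_2$, where $\gamma_i=\gamma_i(n)$. Define $$L_{\mathrm{ap}}w=\sum_{j=1}^ns_j(w)(L_2\psi_j-r_j),\quad L_{\mathrm{res}}w=(L_2-L_{\mathrm{ap}})w=L_2(I-I_n)w+\sum_{j=1}^ns_j(w)r_j,\quad Gw=\sum_{j=1}^ns_j(w)\phi_j.$$ (C) Residual. $\|E\|_{\mathcal H^0}\le\varepsilon_2$. (D) Nonlinearity. There is $K_3>0$ with $|\langle N(u),w\rangle_{\mathcal H^0}|\le K_3\|u\|_{\mathcal H^1}^2\|w\|_{\mathcal H^1}$ and $$|\langle N(u_1)-N(u_2),w_1-w_2\rangle_{\mathcal H^0}|\lesssim(\|u_1\|_{\mathcal H^1}+\|u_2\|_{\mathcal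 H^1})\|u_1-u_2\|_{\mathcal B}\|w_1-w_2\|_{\mathcal B}$$ for all $u,w,u_i,w_i\in\mathcal H^1$. Here $a\lesssim b$ means $a\le Cb$ for some constant $C>0$ (not depending on the functions involved). *)

theory Defs
  imports "HOL-Analysis.Analysis"
begin

text \<open>
  The spaces \<open>H1 \<subseteq> B \<subseteq> H0\<close> are types \<open>'v\<close>, \<open>'b\<close>, \<open>'h\<close>, each carrying its own norm, connected by
  injective linear maps in place of inclusions.  Weak equations, i.e. equations paired with all
  elements of \<open>H1\<close>, are equations between elements of the dual of \<open>H1\<close>.  The duality pairing
  of \<open>F\<close> with \<open>v\<close> is \<open>blinfun_apply F v\<close>; it extends the inner product of \<open>H0\<close>
  through \<open>dual_of\<close>.
\<close>

type_synonym 'v dual = "'v \<Rightarrow>\<^sub>L real"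

definition dense_embedding :: "('a::real_normed_vector \<Rightarrow> 'c::real_normed_vector) \<Rightarrow> bool" where
  "dense_embedding e \<longleftrightarrow> bounded_linear e \<and> inj e \<and> closure (range e) = UNIV"

definition compact_operator :: "('a::real_normed_vector \<Rightarrow> 'c::real_normed_vector) \<Rightarrow> bool" where
  "compact_operator T \<longleftrightarrow> linear T \<and> (\<forall>A. bounded A \<longrightarrow> compact (closure (T ` A)))"

text \<open>
  The functional that an element \<open>h\<close> of \<open>H0\<close> induces on \<open>H1\<close>; \<open>Blinfun\<close> is meaningful here
  because the embedding \<open>e\<close> is bounded, see \<open>dual_of_apply\<close>.
\<close>

definition dual_of :: "('v::real_normed_vector \<Rightarrow> 'h::real_inner) \<Rightarrow> 'h \<Rightarrow> 'v dual" where
  "dual_of e h = Blinfun (\<lambda>v. h \<bullet> e v)"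

lemma dual_of_apply:
  assumes "bounded_linear e"
  shows "blinfun_apply (dual_of e h) v = h \<bullet> e v"
  unfolding dual_of_def
  by (simp add: bounded_linear_Blinfun_apply
      bounded_linear_compose[OF bounded_linear_inner_right assms])

definition L_full ::
  "('v::real_normed_vector \<Rightarrow> 'h::real_inner) \<Rightarrow> ('v \<Rightarrow> 'v dual) \<Rightarrow> ('h \<Rightarrow> 'h) \<Rightarrow> 'v \<Rightarrow> 'v dual" where
  "L_full e L1 L2 f = L1 f + dual_of e (L2 (e f))"

definition L_ap ::
  "nat \<Rightarrow> ('h::real_vector \<Rightarrow> 'h) \<Rightarrow> (nat \<Rightarrow> 'v \<Rightarrow> real) \<Rightarrow> (nat \<Rightarrow> 'h) \<Rightarrow> (nat \<Rightarrow> 'h) \<Rightarrow> 'v \<Rightarrow> 'h" where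
  "L_ap n L2 s \<psi> r w = (\<Sum>j=1..n. s j w *\<^sub>R (L2 (\<psi> j) - r j))"

definition L_res ::
  "('v \<Rightarrow> 'h) \<Rightarrow> nat \<Rightarrow> ('h::real_vector \<Rightarrow> 'h) \<Rightarrow> (nat \<Rightarrow> 'v \<Rightarrow> real) \<Rightarrow> (nat \<Rightarrow> 'h) \<Rightarrow> (nat \<Rightarrow> 'h) \<Rightarrow> 'v \<Rightarrow> 'h" where
  "L_res e n L2 s \<psi> r w = L2 (e w) - L_ap n L2 s \<psi> r w"

lemma L_res_alt:
  assumes "linear L2" and "I w = (\<Sum>j=1..n. s j w *\<^sub>R \<psi> j)"
  shows "L_res e n L2 s \<psi> r w = L2 (e w - I w) + (\<Sum>j=1..n. s j w *\<^sub>R r j)"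
  unfolding L_res_def L_ap_def assms(2)
  by (simp add: linear_diff[OF assms(1)] linear_sum[OF assms(1)] linear_cmul[OF assms(1)]
      scaleR_diff_right sum_subtractf)

definition G_op ::
  "nat \<Rightarrow> (nat \<Rightarrow> 'v \<Rightarrow> real) \<Rightarrow> (nat \<Rightarrow> 'v) \<Rightarrow> 'v \<Rightarrow> 'v::real_vector" where
  "G_op n s \<phi> w = (\<Sum>j=1..n. s j w *\<^sub>R \<phi> j)"

end

theory Submission
  imports Defs
begin

text \<open>
  Put \<open>w2 = G w1\<close>.  Because \<open>L \<phi>\<^sub>i = - L2 \<psi>\<^sub>i + r\<^sub>i\<close>, the second equation of the system holds
  identically, and adding the two equations gives \<open>L (w1 + w2) + N (w1 + w2) + E = 0\<close>, that is
  \<open>J (wbar + w1 + w2) = 0\<close>.  So it remains to solve the first equation for \<open>w1\<close> in the ball of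
  radius \<open>xw\<close>.

  Replacing \<open>L2\<close> by \<open>L_res\<close> is what makes the linear part invertible: \<open>L_res\<close> has norm at most
  \<open>K2 * \<delta>1 + \<gamma>1 * \<epsilon>1\<close> from \<open>H1\<close> to \<open>H0\<close>, so \<open>A = L1 + L_res\<close> is coercive on \<open>H1\<close> with constant
  \<open>\<kappa>\<close>, although \<open>L\<close> itself need not be.  By \<open>lax_milgram\<close> there is a map \<open>F\<close> with
  \<open>A (F u) = - E - N (u + G u)\<close>, and its fixed points are the solutions.  Testing this equation
  with \<open>F u\<close> gives \<open>\<kappa> * norm (F u) \<le> K0 * \<epsilon>2 + K3 * (1 + \<gamma>1 * \<gamma>2)\<^sup>2 * (norm u)\<^sup>2\<close>, and \<open>xw\<close> is
  the smaller root of the corresponding quadratic equation, so \<open>F\<close> maps the ball of radius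
  \<open>xw\<close> into itself.

  The Lipschitz constant of \<open>N\<close> may be large, so \<open>F\<close> need not be a contraction and a compactness
  argument is used.  The Lipschitz bound on \<open>N\<close> is in terms of the norm of \<open>B\<close>; tested with
  \<open>F u - F v\<close>, it shows that \<open>F u\<close> depends in a Lipschitz way on the image of \<open>u + G u\<close> in \<open>B\<close>.
  The embedding of \<open>H1\<close> into \<open>B\<close> is compact, hence so is the closure of the image of the ball
  under \<open>F\<close> (\<open>compact_closure_image_via_lipschitz_factor\<close>), and \<open>schauder_fixed_point\<close> applies.

  Schauder's theorem is reduced to a fixed point theorem for the Hilbert cube, proved from
  Kuhn's combinatorial lemma.  The cube is a single space that contains simplices of every
  dimension, so the number of points of a finite net may depend on the data.  The finite
  dimensional Brouwer theorem for Euclidean spaces would fix the dimension through a type.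
\<close>

section \<open>A fixed point theorem for the Hilbert cube\<close>

text \<open>
  The topology that matters is that of pointwise convergence, the product topology on
  \<^typ>\<open>nat \<Rightarrow> real\<close>.
\<close>
definition hilbert_cube :: "(nat \<Rightarrow> real) set" where
  "hilbert_cube = {x. \<forall>i. 0 \<le> x i \<and> x i \<le> 1}"

lemma tendsto_fun_iff_pointwise:
  fixes f :: "'a \<Rightarrow> nat \<Rightarrow> real"
  shows "(f \<longlongrightarrow> l) F \<longleftrightarrow> (\<forall>i. ((\<lambda>k. f k i) \<longlongrightarrow> l i) F)"
proof -
  have "(f \<longlongrightarrow> l) F \<longleftrightarrow> limitin (product_topology (\<lambda>i. euclidean) UNIV) f l F"
    by (simp only: euclidean_product_topology limitin_canonical_iff)
  then show ?thesis
    by (simp add: limitin_componentwise)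
qed

lemma compact_hilbert_cube: "compact hilbert_cube"
proof -
  have "hilbert_cube = PiE UNIV (\<lambda>i::nat. {0..1::real})"
    by (auto simp: hilbert_cube_def PiE_def Pi_def)
  moreover have "compactin euclidean (PiE UNIV (\<lambda>i::nat. {0..1::real}))"
    unfolding euclidean_product_topology[symmetric] compactin_PiE by simp
  ultimately show ?thesis
    by simp
qed

text \<open>
  Sperner's argument on a grid of mesh \<open>1 / p\<close> in the first \<open>p\<close> coordinates.  A label 0 of a
  point in coordinate \<open>i\<close> certifies that \<open>f\<close> does not decrease this coordinate there, a label 1
  that \<open>f\<close> does not increase it; the boundary labels that Kuhn's lemma requires are certified
  because \<open>f\<close> stays in the cube.  The lemma yields a small grid cell in which every coordinate
  receives both labels, so in the limit \<open>f\<close> can neither raise nor lower any coordinate.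
\<close>
lemma hilbert_cube_kuhn_point:
  fixes f :: "(nat \<Rightarrow> real) \<Rightarrow> nat \<Rightarrow> real"
  assumes f: "\<And>x. x \<in> hilbert_cube \<Longrightarrow> f x \<in> hilbert_cube" and p: "0 < p"
  shows "\<exists>z\<in>hilbert_cube. \<forall>i<p. \<exists>a\<in>hilbert_cube. \<exists>b\<in>hilbert_cube.
           (\<forall>j. \<bar>a j - z j\<bar> \<le> 1 / real p \<and> \<bar>b j - z j\<bar> \<le> 1 / real p) \<and> a i \<le> f a i \<and> f b i \<le> b i"
proof -
  obtain l :: "(nat \<Rightarrow> real) \<Rightarrow> nat \<Rightarrow> nat" where
    l_le: "\<And>x i. l x i \<le> 1" and
    l0: "\<And>x i. x \<in> hilbert_cube \<Longrightarrow> x i = 0 \<Longrightarrow> l x i = 0" and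
    l1: "\<And>x i. x \<in> hilbert_cube \<Longrightarrow> x i = 1 \<Longrightarrow> l x i = 1" and
    up: "\<And>x i. x \<in> hilbert_cube \<Longrightarrow> l x i = 0 \<Longrightarrow> x i \<le> f x i" and
    down: "\<And>x i. x \<in> hilbert_cube \<Longrightarrow> l x i = 1 \<Longrightarrow> f x i \<le> x i"
  proof -
    have self: "\<forall>x. x \<in> hilbert_cube \<longrightarrow> f x \<in> hilbert_cube"
      using f by blast
    have range: "\<forall>x. x \<in> hilbert_cube \<longrightarrow> (\<forall>i::nat. True \<longrightarrow> 0 \<le> x i \<and> x i \<le> 1)"
      by (simp add: hilbert_cube_def)
    from kuhn_labelling_lemma'[OF self range] show thesis
      by (elim exE conjE) (rule that; blast)
  qed
  define grid :: "(nat \<Rightarrow> nat) \<Rightarrow> nat \<Rightarrow> real"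
    where "grid q = (\<lambda>j. if j < p then real (q j) / real p else 0)" for q
  have grid: "grid q \<in> hilbert_cube" if "\<forall>i<p. q i \<le> p" for q
    using that p by (auto simp: grid_def hilbert_cube_def)
  have label01: "l x i = 0 \<or> l x i = 1" for x i
    using l_le[of x i] by linarith
  obtain q where q: "\<forall>i<p. q i < p" and
    rs: "\<forall>i<p. \<exists>r s. (\<forall>j<p. q j \<le> r j \<and> r j \<le> q j + 1) \<and> (\<forall>j<p. q j \<le> s j \<and> s j \<le> q j + 1) \<and>
           l (grid r) i \<noteq> l (grid s) i"
  proof (rule kuhn_lemma[of p p "\<lambda>q. l (grid q)"])
    show "\<forall>x. (\<forall>i<p. x i \<le> p) \<longrightarrow> (\<forall>i<p. x i = 0 \<longrightarrow> l (grid x) i = 0)"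
      using grid by (intro allI impI l0) (simp_all add: grid_def)
    show "\<forall>x. (\<forall>i<p. x i \<le> p) \<longrightarrow> (\<forall>i<p. x i = p \<longrightarrow> l (grid x) i = 1)"
      using grid p by (intro allI impI l1) (simp_all add: grid_def)
  qed (use p label01 in auto)
  have near: "grid r \<in> hilbert_cube \<and> (\<forall>j. \<bar>grid r j - grid q j\<bar> \<le> 1 / real p)"
    if r: "\<forall>j<p. q j \<le> r j \<and> r j \<le> q j + 1" for r
  proof
    show "grid r \<in> hilbert_cube"
      using q r by (intro grid) fastforce
    show "\<forall>j. \<bar>grid r j - grid q j\<bar> \<le> 1 / real p"
    proof
      fix j
      show "\<bar>grid r j - grid q j\<bar> \<le> 1 / real p"
      proof (cases "j < p")
        case True
        then have "\<bar>real (r j) - real (q j)\<bar> \<le> 1"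
          using r by (smt (verit) of_nat_1 of_nat_add of_nat_mono)
        moreover have "grid r j - grid q j = (real (r j) - real (q j)) / real p"
          using True by (simp add: grid_def diff_divide_distrib)
        ultimately show ?thesis
          using p by (simp add: abs_divide divide_right_mono)
      qed (simp add: grid_def)
    qed
  qed
  show ?thesis
  proof (rule bexI[of _ "grid q"], intro allI impI)
    show "grid q \<in> hilbert_cube"
      using q by (intro grid) auto
    fix i assume "i < p"
    then obtain r s where r: "\<forall>j<p. q j \<le> r j \<and> r j \<le> q j + 1"
      and s: "\<forall>j<p. q j \<le> s j \<and> s j \<le> q j + 1" and "l (grid r) i \<noteq> l (grid s) i"
      using rs by blast
    with label01 consider "l (grid r) i = 0" "l (grid s) i = 1" | "l (grid s) i = 0" "l (grid r) i = 1"
      by metis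
    then show "\<exists>a\<in>hilbert_cube. \<exists>b\<in>hilbert_cube.
        (\<forall>j. \<bar>a j - grid q j\<bar> \<le> 1 / real p \<and> \<bar>b j - grid q j\<bar> \<le> 1 / real p) \<and> a i \<le> f a i \<and> f b i \<le> b i"
      by cases (use near[OF r] near[OF s] up down in \<open>blast+\<close>)
  qed
qed

text \<open>
  Mesh size and number of gridded coordinates are controlled by the same \<open>p\<close>.  A cluster point
  of the cells, which exists by compactness, is therefore treated in every coordinate.
\<close>
lemma hilbert_cube_fixed_point:
  fixes f :: "(nat \<Rightarrow> real) \<Rightarrow> nat \<Rightarrow> real"
  assumes cont: "continuous_on hilbert_cube f"
    and f: "\<And>x. x \<in> hilbert_cube \<Longrightarrow> f x \<in> hilbert_cube"
  obtains x where "x \<in> hilbert_cube" "f x = x"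
proof -
  have "\<exists>z\<in>hilbert_cube. \<forall>i<Suc p. \<exists>a\<in>hilbert_cube. \<exists>b\<in>hilbert_cube.
      (\<forall>j. \<bar>a j - z j\<bar> \<le> 1 / real (Suc p) \<and> \<bar>b j - z j\<bar> \<le> 1 / real (Suc p)) \<and> a i \<le> f a i \<and> f b i \<le> b i" for p
    by (rule hilbert_cube_kuhn_point[OF f]) auto
  then obtain z a b where z: "\<And>p. z p \<in> hilbert_cube"
    and ab: "\<And>p i. i < Suc p \<Longrightarrow> a p i \<in> hilbert_cube \<and> b p i \<in> hilbert_cube \<and>
      (\<forall>j. \<bar>a p i j - z p j\<bar> \<le> 1 / real (Suc p) \<and> \<bar>b p i j - z p j\<bar> \<le> 1 / real (Suc p)) \<and>
      a p i i \<le> f (a p i) i \<and> f (b p i) i \<le> b p i i"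
    by metis
  obtain x \<sigma> where x: "x \<in> hilbert_cube" and \<sigma>: "strict_mono \<sigma>" and lim: "(z \<circ> \<sigma>) \<longlonglongrightarrow> x"
    using compact_hilbert_cube z unfolding compact_eq_seq_compact_metric
    by (meson seq_compactE)
  have mesh: "(\<lambda>p. 1 / real (Suc (\<sigma> p))) \<longlonglongrightarrow> 0"
    using LIMSEQ_subseq_LIMSEQ[OF LIMSEQ_Suc[OF lim_1_over_n] \<sigma>] by (simp add: o_def)
  have limit: "c \<longlonglongrightarrow> x \<and> (\<lambda>p. f (c p)) \<longlonglongrightarrow> f x"
    if c: "\<forall>\<^sub>F p in sequentially. c p \<in> hilbert_cube \<and> (\<forall>j. \<bar>c p j - z (\<sigma> p) j\<bar> \<le> 1 / real (Suc (\<sigma> p)))" for c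
  proof
    show "c \<longlonglongrightarrow> x"
      unfolding tendsto_fun_iff_pointwise
    proof
      fix j
      have "(\<lambda>p. c p j - z (\<sigma> p) j) \<longlonglongrightarrow> 0"
        by (rule Lim_null_comparison[OF _ mesh]) (use c in \<open>auto elim: eventually_mono\<close>)
      moreover have "(\<lambda>p. z (\<sigma> p) j) \<longlonglongrightarrow> x j"
        using lim by (simp add: tendsto_fun_iff_pointwise o_def)
      ultimately show "(\<lambda>p. c p j) \<longlonglongrightarrow> x j"
        using tendsto_add by fastforce
    qed
    then show "(\<lambda>p. f (c p)) \<longlonglongrightarrow> f x"
      by (rule continuous_on_tendsto_compose[OF cont _ x]) (use c in \<open>auto elim: eventually_mono\<close>)
  qed
  have "f x i = x i" for i
  proof -
    have late: "\<forall>\<^sub>F p in sequentially. i < Suc (\<sigma> p)"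
      using eventually_ge_at_top[of i]
      by eventually_elim (use seq_suble[OF \<sigma>] in \<open>meson le_trans less_Suc_eq_le\<close>)
    have "(\<lambda>p. a (\<sigma> p) i) \<longlonglongrightarrow> x \<and> (\<lambda>p. f (a (\<sigma> p) i)) \<longlonglongrightarrow> f x"
      by (rule limit) (use late in eventually_elim, use ab in blast)
    moreover have "\<forall>\<^sub>F p in sequentially. a (\<sigma> p) i i \<le> f (a (\<sigma> p) i) i"
      using late by eventually_elim (use ab in blast)
    ultimately have "x i \<le> f x i"
      by (intro tendsto_le[of sequentially]) (auto simp: tendsto_fun_iff_pointwise)
    have "(\<lambda>p. b (\<sigma> p) i) \<longlonglongrightarrow> x \<and> (\<lambda>p. f (b (\<sigma> p) i)) \<longlonglongrightarrow> f x"
      by (rule limit) (use late in eventually_elim, use ab in blast)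
    moreover have "\<forall>\<^sub>F p in sequentially. f (b (\<sigma> p) i) i \<le> b (\<sigma> p) i i"
      using late by eventually_elim (use ab in blast)
    ultimately have "f x i \<le> x i"
      by (intro tendsto_le[of sequentially]) (auto simp: tendsto_fun_iff_pointwise)
    with \<open>x i \<le> f x i\<close> show ?thesis
      by simp
  qed
  with x that show ?thesis
    by blast
qed

section \<open>Schauder's fixed point theorem\<close>

text \<open>
  Following \<open>f\<close> by the Schauder projection onto the convex hull of a finite \<open>\<epsilon>\<close>-net of its
  image moves values by at most \<open>\<epsilon>\<close>.  The projected map is described by barycentric coordinates, so
  it can be transported to the Hilbert cube, where it has a fixed point.
\<close>
lemma schauder_approximate_fixed_point:
  fixes f :: "'a::real_normed_vector \<Rightarrow> 'a"
  assumes K: "convex K" "closed K" "K \<noteq> {}"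
    and cont: "continuous_on K f" and self: "f ` K \<subseteq> K" and comp: "compact (closure (f ` K))"
    and \<epsilon>: "0 < \<epsilon>"
  shows "\<exists>u\<in>K. norm (f u - u) \<le> \<epsilon>"
proof -
  have CK: "closure (f ` K) \<subseteq> K"
    by (simp add: K closure_minimal self)
  obtain Y where Y: "finite Y" "Y \<subseteq> closure (f ` K)" "closure (f ` K) \<subseteq> (\<Union>y\<in>Y. ball y \<epsilon>)"
    using comp \<epsilon> by (metis seq_compact_imp_totally_bounded compact_imp_seq_compact)
  obtain m and y :: "nat \<Rightarrow> 'a" where y: "Y = y ` {..<m}"
    using finite_imp_nat_seg_image_inj_on[OF Y(1)] by (auto simp: lessThan_def)
  have "Y \<noteq> {}"
    using Y(3) K(3) closure_subset[of "f ` K"] by auto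
  then have m: "0 < m"
    using y by (cases m) auto
  have yK: "y j \<in> K" if "j < m" for j
    using that y Y(2) CK by auto

  \<comment> \<open>The partition of unity behind the Schauder projection onto the convex hull of the net.\<close>
  define h where "h j x = max 0 (\<epsilon> - dist x (y j))" for j x
  define H where "H x = (\<Sum>j<m. h j x)" for x
  define \<mu> where "\<mu> j x = h j x / H x" for j x
  have h_nonneg: "0 \<le> h j x" for j x
    by (simp add: h_def)
  have H_pos: "0 < H x" if "x \<in> f ` K" for x
  proof -
    have "x \<in> (\<Union>y\<in>Y. ball y \<epsilon>)"
      using that Y(3) closure_subset[of "f ` K"] by blast
    then obtain j where "j < m" "0 < h j x"
      by (auto simp: y h_def dist_commute)
    then show ?thesis
      unfolding H_def by (intro sum_pos2[of _ j]) (auto simp: h_nonneg)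
  qed
  have \<mu>_nonneg: "0 \<le> \<mu> j x" if "x \<in> f ` K" for j x
    using H_pos[OF that] by (simp add: \<mu>_def h_nonneg)
  have \<mu>_sum: "(\<Sum>j<m. \<mu> j x) = 1" if "x \<in> f ` K" for x
    using H_pos[OF that] by (simp add: \<mu>_def H_def flip: sum_divide_distrib)
  have \<mu>_cont: "continuous_on (f ` K) (\<mu> j)" for j
    unfolding \<mu>_def H_def h_def
    by (intro continuous_intros ballI) (use H_pos in \<open>force simp: H_def h_def\<close>)

  \<comment> \<open>A retraction of the cube onto the simplex: missing mass goes to the first vertex,
    excess mass is divided away.\<close>
  define mass where "mass t = (\<Sum>j<m. t j)" for t :: "nat \<Rightarrow> real"
  define c where "c t j = (t j + of_bool (j = 0) * max 0 (1 - mass t)) / max 1 (mass t)"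
    for t :: "nat \<Rightarrow> real" and j
  define comb where "comb t = (\<Sum>j<m. c t j *\<^sub>R y j)" for t :: "nat \<Rightarrow> real"
  have coord: "continuous_on hilbert_cube (\<lambda>t. t j)" for j
    by (rule continuous_on_subset[OF continuous_on_product_coordinates]) simp
  have comb_cont: "continuous_on hilbert_cube comb"
    unfolding comb_def c_def mass_def
    by (intro continuous_intros coord) auto
  have c_sum: "(\<Sum>j<m. c t j) = 1" for t
  proof -
    have "(\<Sum>j<m. of_bool (j = 0) * b) = b" for b :: real
      using m by (subst sum.remove[of _ 0]) auto
    then have "(\<Sum>j<m. c t j) = (mass t + max 0 (1 - mass t)) / max 1 (mass t)"
      by (simp only: c_def sum_divide_distrib[symmetric] sum.distrib mass_def[symmetric])
    also have "mass t + max 0 (1 - mass t) = max 1 (mass t)"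
      by (simp add: max_def)
    finally show ?thesis
      by (simp add: max_def)
  qed
  have comb_K: "comb t \<in> K" if "t \<in> hilbert_cube" for t
    unfolding comb_def
    by (rule convex_sum[OF _ K(1) c_sum]) (use that yK in \<open>auto simp: c_def hilbert_cube_def\<close>)

  define g where "g t j = (if j < m then \<mu> j (f (comb t)) else 0)" for t j
  have "continuous_on hilbert_cube (\<lambda>t. g t j)" for j
  proof (cases "j < m")
    case True
    have "continuous_on hilbert_cube (\<lambda>t. \<mu> j (f (comb t)))"
    proof (rule continuous_on_compose2[OF \<mu>_cont])
      show "continuous_on hilbert_cube (\<lambda>t. f (comb t))"
        by (rule continuous_on_compose2[OF cont comb_cont]) (use comb_K in auto)
    qed (use comb_K in auto)
    with True show ?thesis
      by (simp add: g_def)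
  qed (simp add: g_def)
  then have g_cont: "continuous_on hilbert_cube g"
    by (rule continuous_on_coordinatewise_then_product)
  have g_self: "g t \<in> hilbert_cube" if "t \<in> hilbert_cube" for t
  proof -
    have x: "f (comb t) \<in> f ` K"
      using comb_K[OF that] by blast
    have "\<mu> j (f (comb t)) \<le> 1" if "j < m" for j
      using member_le_sum[of j "{..<m}" "\<lambda>j. \<mu> j (f (comb t))"] that \<mu>_nonneg[OF x] \<mu>_sum[OF x] by simp
    then show ?thesis
      using \<mu>_nonneg[OF x] by (simp add: hilbert_cube_def g_def)
  qed
  obtain t where t: "t \<in> hilbert_cube" "g t = t"
    using hilbert_cube_fixed_point[OF g_cont g_self] by blast
  define u where "u = comb t"
  have uK: "u \<in> K"
    using comb_K t(1) u_def by blast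
  then have fu: "f u \<in> f ` K"
    by blast
  have t_eq: "t j = \<mu> j (f u)" if "j < m" for j
    using that fun_cong[OF t(2), of j] by (simp add: g_def u_def)
  \<comment> \<open>The fixed point lies on the simplex, where the retraction is the identity.\<close>
  have "mass t = 1"
    using t_eq \<mu>_sum[OF fu] by (simp add: mass_def)
  then have c_eq: "c t j = t j" for j
    by (simp add: c_def)
  have "u = (\<Sum>j<m. t j *\<^sub>R y j)"
    by (simp add: u_def comb_def c_eq)
  also have "\<dots> = (\<Sum>j<m. \<mu> j (f u) *\<^sub>R y j)"
    by (intro sum.cong) (simp_all add: t_eq)
  finally have "u = (\<Sum>j<m. \<mu> j (f u) *\<^sub>R y j)" .
  moreover have "f u = (\<Sum>j<m. \<mu> j (f u) *\<^sub>R f u)"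
    using \<mu>_sum[OF fu] by (simp flip: scaleR_left.sum)
  ultimately have "f u - u = (\<Sum>j<m. \<mu> j (f u) *\<^sub>R (f u - y j))"
    by (simp add: scaleR_diff_right sum_subtractf)
  also have "norm \<dots> \<le> (\<Sum>j<m. \<mu> j (f u) * \<epsilon>)"
  proof (rule sum_norm_le)
    fix j
    show "norm (\<mu> j (f u) *\<^sub>R (f u - y j)) \<le> \<mu> j (f u) * \<epsilon>"
    proof (cases "dist (f u) (y j) \<le> \<epsilon>")
      case True
      then show ?thesis
        using \<mu>_nonneg[OF fu] by (simp add: dist_norm mult_left_mono)
    next
      case False
      then have "\<mu> j (f u) = 0"
        by (simp add: \<mu>_def h_def)
      then show ?thesis
        by simp
    qed
  qed
  also have "\<dots> = \<epsilon>"
    using \<mu>_sum[OF fu] by (simp flip: sum_distrib_right)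
  finally show ?thesis
    using uK by blast
qed

text \<open>
  If the values of \<open>f\<close> at approximate fixed points cluster at \<open>v\<close>, then so do the approximate
  fixed points themselves.
\<close>
theorem schauder_fixed_point:
  fixes f :: "'a::real_normed_vector \<Rightarrow> 'a"
  assumes K: "convex K" "closed K" "K \<noteq> {}"
    and cont: "continuous_on K f" and self: "f ` K \<subseteq> K" and comp: "compact (closure (f ` K))"
  obtains u where "u \<in> K" "f u = u"
proof -
  have "\<exists>u\<in>K. norm (f u - u) \<le> 1 / real (Suc k)" for k
    by (rule schauder_approximate_fixed_point[OF assms]) simp
  then obtain u where u: "\<And>k. u k \<in> K" and close: "\<And>k. norm (f (u k) - u k) \<le> 1 / real (Suc k)"
    by metis
  have "f (u k) \<in> closure (f ` K)" for k
    using u closure_subset by blast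
  then obtain v \<sigma> where v: "v \<in> closure (f ` K)" and \<sigma>: "strict_mono \<sigma>"
    and lim: "(\<lambda>k. f (u (\<sigma> k))) \<longlonglongrightarrow> v"
    using comp[unfolded compact_eq_seq_compact_metric]
    by (auto elim!: seq_compactE[of _ "\<lambda>k. f (u k)"] simp: o_def)
  have vK: "v \<in> K"
    using v K(2) self by (meson closure_minimal subsetD)
  have "(\<lambda>k. 1 / real (Suc (\<sigma> k))) \<longlonglongrightarrow> 0"
    using LIMSEQ_subseq_LIMSEQ[OF LIMSEQ_Suc[OF lim_1_over_n] \<sigma>] by (simp add: o_def)
  then have "(\<lambda>k. f (u (\<sigma> k)) - u (\<sigma> k)) \<longlonglongrightarrow> 0"
    by (rule Lim_null_comparison[rotated]) (simp add: close del: of_nat_Suc)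
  from tendsto_diff[OF lim this] have "(\<lambda>k. u (\<sigma> k)) \<longlonglongrightarrow> v"
    by simp
  then have "(\<lambda>k. f (u (\<sigma> k))) \<longlonglongrightarrow> f v"
    by (rule continuous_on_tendsto_compose[OF cont _ vK]) (simp add: u)
  with lim have "f v = v"
    using LIMSEQ_unique by blast
  with vK that show ?thesis
    by blast
qed

text \<open>
  The bound makes \<open>f\<close> factor as a Lipschitz map after \<open>T\<close>.  That map extends to the compact
  closure of \<open>T ` A\<close>, since its target is complete, and the image of the extension is compact.
\<close>
lemma compact_closure_image_via_lipschitz_factor:
  fixes f :: "'a \<Rightarrow> 'c::complete_space" and T :: "'a \<Rightarrow> 'b::metric_space"
  assumes comp: "compact (closure (T ` A))"
    and lip: "\<And>x y. x \<in> A \<Longrightarrow> y \<in> A \<Longrightarrow> dist (f x) (f y) \<le> D * dist (T x) (T y)"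
  shows "compact (closure (f ` A))"
proof -
  define g where "g t = f (SOME x. x \<in> A \<and> T x = t)" for t
  have rep: "(SOME x. x \<in> A \<and> T x = t) \<in> A \<and> T (SOME x. x \<in> A \<and> T x = t) = t" if "t \<in> T ` A" for t
    using that by (intro someI_ex[of "\<lambda>x. x \<in> A \<and> T x = t"]) blast
  have g_lip: "dist (g s) (g t) \<le> D * dist s t" if "s \<in> T ` A" "t \<in> T ` A" for s t
    using lip rep[OF that(1)] rep[OF that(2)] unfolding g_def by metis
  have g_T: "g (T x) = f x" if "x \<in> A" for x
    using lip[of "SOME x'. x' \<in> A \<and> T x' = T x" x] rep[of "T x"] that by (simp add: g_def)
  have "uniformly_continuous_on (T ` A) g"
    unfolding uniformly_continuous_on_def
  proof (intro allI impI)
    fix e :: real assume e: "0 < e"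
    show "\<exists>d>0. \<forall>x\<in>T ` A. \<forall>x'\<in>T ` A. dist x' x < d \<longrightarrow> dist (g x') (g x) < e"
    proof (intro exI conjI ballI impI)
      show "0 < e / (\<bar>D\<bar> + 1)"
        using e by simp
      fix x x' assume x: "x \<in> T ` A" "x' \<in> T ` A" and d: "dist x' x < e / (\<bar>D\<bar> + 1)"
      have "dist (g x') (g x) \<le> (\<bar>D\<bar> + 1) * dist x' x"
        using g_lip[OF x(2,1)] by (rule order_trans) (intro mult_right_mono, auto)
      also have "\<dots> < e"
        using d by (simp add: field_simps)
      finally show "dist (g x') (g x) < e" .
    qed
  qed
  then obtain g' where g': "uniformly_continuous_on (closure (T ` A)) g'"
    "\<And>t. t \<in> T ` A \<Longrightarrow> g t = g' t"
    by (metis uniformly_continuous_on_extension_on_closure)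
  have "compact (g' ` closure (T ` A))"
    using comp g'(1) compact_continuous_image uniformly_continuous_imp_continuous by blast
  moreover have "f ` A \<subseteq> g' ` closure (T ` A)"
  proof
    fix z assume "z \<in> f ` A"
    then obtain x where "x \<in> A" "z = g' (T x)"
      using g_T g'(2) by force
    then show "z \<in> g' ` closure (T ` A)"
      using closure_subset by fast
  qed
  ultimately have "closure (f ` A) \<subseteq> g' ` closure (T ` A)"
    by (simp add: closure_minimal compact_imp_closed)
  with \<open>compact (g' ` closure (T ` A))\<close> have "compact (g' ` closure (T ` A) \<inter> closure (f ` A))"
    by (simp add: compact_Int_closed)
  with \<open>closure (f ` A) \<subseteq> g' ` closure (T ` A)\<close> show ?thesis
    by (simp add: inf.absorb2)
qed

section \<open>The Lax--Milgram theorem\<close>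

text \<open>
  The representing vector minimises \<open>v \<bullet> v - 2 * F v\<close>: minimising sequences are Cauchy by the
  parallelogram law, and the first variation vanishes at the minimum.
\<close>
lemma riesz_representation:
  fixes F :: "'v::{real_inner, complete_space} \<Rightarrow>\<^sub>L real"
  shows "\<exists>!z. \<forall>v. blinfun_apply F v = z \<bullet> v"
proof -
  define q where "q v = v \<bullet> v - 2 * blinfun_apply F v" for v
  define m where "m = (INF v. q v)"
  have lower: "- (norm F)\<^sup>2 \<le> q v" for v
  proof -
    have "blinfun_apply F v \<le> norm F * norm v"
      using norm_blinfun[of F v] by simp
    moreover have "0 \<le> (norm v - norm F)\<^sup>2"
      by simp
    ultimately show ?thesis
      unfolding q_def power2_norm_eq_inner[symmetric] power2_diff by (simp add: algebra_simps)
  qed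
  then have bdd: "bdd_below (range q)"
    by (intro bdd_belowI2) auto
  have m_le: "m \<le> q v" for v
    unfolding m_def by (rule cINF_lower[OF bdd]) simp
  have parallelogram: "(norm (a - b))\<^sup>2 \<le> 2 * (q a - m) + 2 * (q b - m)" for a b
  proof -
    have "(norm (a - b))\<^sup>2 = 2 * q a + 2 * q b - 4 * q ((1/2) *\<^sub>R (a + b))"
      unfolding q_def power2_norm_eq_inner
      by (simp add: blinfun.add_right blinfun.scaleR_right inner_add inner_diff inner_commute algebra_simps)
    with m_le[of "(1/2) *\<^sub>R (a + b)"] show ?thesis
      by simp
  qed
  have "\<exists>v. q v < m + 1 / real (Suc k)" for k
    using cINF_less_iff[OF _ bdd, of "m + 1 / real (Suc k)"] by (simp add: m_def)
  then obtain v where v: "\<And>k. q (v k) < m + 1 / real (Suc k)"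
    by metis
  have "Cauchy v"
  proof (rule metric_CauchyI)
    fix e :: real assume e: "0 < e"
    obtain n where n: "1 / real (Suc n) < e\<^sup>2 / 4"
      using reals_Archimedean[of "e\<^sup>2 / 4"] e by (auto simp: inverse_eq_divide)
    have small: "q (v k) - m < e\<^sup>2 / 4" if "k \<ge> n" for k
    proof -
      have "1 / real (Suc k) \<le> 1 / real (Suc n)"
        using that by (simp add: frac_le)
      with v[of k] n show ?thesis
        by simp
    qed
    have "dist (v k) (v l) < e" if "k \<ge> n" "l \<ge> n" for k l
    proof -
      have "(norm (v k - v l))\<^sup>2 < e\<^sup>2"
        using parallelogram[of "v k" "v l"] small[OF that(1)] small[OF that(2)] by simp
      then show ?thesis
        using e by (simp add: dist_norm power2_less_imp_less)
    qed
    then show "\<exists>M. \<forall>k\<ge>M. \<forall>l\<ge>M. dist (v k) (v l) < e"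
      by blast
  qed
  then obtain z where z: "v \<longlonglongrightarrow> z"
    using Cauchy_convergent_iff convergent_def by blast
  have "(\<lambda>k. q (v k)) \<longlonglongrightarrow> q z"
    unfolding q_def by (intro tendsto_intros z)
  moreover have "(\<lambda>k. m + 1 / real (Suc k)) \<longlonglongrightarrow> m + 0"
    by (intro tendsto_intros LIMSEQ_Suc[OF lim_1_over_n])
  ultimately have qz: "q z \<le> m"
    using v by (intro tendsto_le[of sequentially "\<lambda>k. m + 1 / real (Suc k)" m "\<lambda>k. q (v k)"])
      (auto simp: less_imp_le)
  have "blinfun_apply F w = z \<bullet> w" for w
  proof -
    define b where "b = blinfun_apply F w - z \<bullet> w"
    \<comment> \<open>The step length that minimises the quadratic \<open>q (z + t *\<^sub>R w) - q z = t\<^sup>2 * (w \<bullet> w) - 2 * t * b\<close>,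
      regularised so that \<open>w = 0\<close> needs no separate treatment.\<close>
    define t where "t = b / (w \<bullet> w + 1)"
    have pos: "0 < w \<bullet> w + 1"
      using inner_ge_zero[of w] by linarith
    have "q z \<le> q (z + t *\<^sub>R w)"
      using qz m_le order_trans by blast
    also have "\<dots> = q z + t\<^sup>2 * (w \<bullet> w) - 2 * t * b"
      by (simp add: q_def b_def blinfun.add_right blinfun.scaleR_right inner_add inner_commute
          power2_eq_square algebra_simps)
    finally have "2 * t * b \<le> t\<^sup>2 * (w \<bullet> w)"
      by simp
    also have "\<dots> \<le> t\<^sup>2 * (w \<bullet> w + 1)"
      by (simp add: mult_left_mono)
    also have "\<dots> = t * b"
      using pos by (simp add: t_def power2_eq_square)
    finally have "t * b \<le> 0"
      by (simp add: mult.commute)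
    then have "b\<^sup>2 \<le> 0"
      using pos by (simp add: t_def power2_eq_square divide_le_0_iff)
    then show ?thesis
      by (simp add: b_def)
  qed
  then have "\<forall>v. blinfun_apply F v = z \<bullet> v"
    by blast
  then show ?thesis
  proof (rule ex1I)
    fix z' assume "\<forall>v. blinfun_apply F v = z' \<bullet> v"
    with \<open>\<forall>v. blinfun_apply F v = z \<bullet> v\<close> have "\<forall>v. z' \<bullet> v = z \<bullet> v"
      by simp
    then show "z' = z"
      by (simp only: vector_eq_rdot)
  qed
qed

text \<open>
  Identify functionals with vectors by the Riesz map \<open>R\<close>.  Then \<open>u \<mapsto> u - \<rho> *\<^sub>R R (A u - F)\<close>
  is a contraction for small \<open>\<rho>\<close>, because coercivity decreases the squared distance of two points
  at first order in \<open>\<rho>\<close> while boundedness limits the increase to second order.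
\<close>
theorem lax_milgram:
  fixes A :: "'v::{real_inner, complete_space} \<Rightarrow> 'v \<Rightarrow>\<^sub>L real"
  assumes A: "linear A" and bounded: "\<And>u v. \<bar>blinfun_apply (A u) v\<bar> \<le> C * norm u * norm v"
    and coercive: "\<And>u. \<kappa> * (norm u)\<^sup>2 \<le> blinfun_apply (A u) u" and \<kappa>: "0 < \<kappa>"
  shows "\<exists>u. A u = F"
proof -
  define R where "R G = (THE z. \<forall>v. blinfun_apply G v = z \<bullet> v)" for G :: "'v \<Rightarrow>\<^sub>L real"
  have "\<forall>v. blinfun_apply G v = R G \<bullet> v" for G
    unfolding R_def by (rule theI'[OF riesz_representation])
  then have R: "R G \<bullet> v = blinfun_apply G v" for G v
    by metis
  \<comment> \<open>\<open>D\<close> is also a bound for \<open>A\<close>; it is at least \<open>\<kappa>\<close>, so that \<open>1 - \<kappa>\<^sup>2 / D\<^sup>2\<close> has a real square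
    root.  The bound \<open>1 - 2 * \<rho> * \<kappa> + \<rho>\<^sup>2 * D\<^sup>2\<close> for the squared contraction factor is smallest
    at \<open>\<rho> = \<kappa> / D\<^sup>2\<close>, where it equals this number.\<close>
  define D where "D = max C \<kappa>"
  have D: "\<kappa> \<le> D" "0 < D" and C: "C \<le> D"
    using \<kappa> by (auto simp: D_def)
  define \<rho> where "\<rho> = \<kappa> / D\<^sup>2"
  define T where "T u = u - \<rho> *\<^sub>R R (A u - F)" for u
  define c where "c = sqrt (1 - \<kappa>\<^sup>2 / D\<^sup>2)"
  have ratio: "0 < \<kappa>\<^sup>2 / D\<^sup>2" "\<kappa>\<^sup>2 / D\<^sup>2 \<le> 1"
    using \<kappa> D by (simp_all add: power_mono)
  then have c: "0 \<le> c" "c < 1"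
    by (simp_all add: c_def)
  have contraction: "dist (T u) (T v) \<le> c * dist u v" for u v
  proof -
    define d where "d = u - v"
    define g where "g = R (A d)"
    have "R (A u - F) - R (A v - F) = g"
    proof (rule vector_eq_rdot[THEN iffD1], rule allI)
      fix x
      show "(R (A u - F) - R (A v - F)) \<bullet> x = g \<bullet> x"
        by (simp add: g_def d_def R inner_diff_left blinfun.diff_left linear_diff[OF A])
    qed
    then have "\<rho> *\<^sub>R g = \<rho> *\<^sub>R R (A u - F) - \<rho> *\<^sub>R R (A v - F)"
      by (metis scaleR_diff_right)
    then have diff: "T u - T v = d - \<rho> *\<^sub>R g"
      by (simp add: T_def d_def)
    have "norm g * norm g = blinfun_apply (A d) g"
      by (simp add: g_def R[symmetric] norm_eq_sqrt_inner)
    also have "\<dots> \<le> C * norm d * norm g"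
      using bounded[of d g] by linarith
    also have "\<dots> \<le> D * norm d * norm g"
      using C by (intro mult_right_mono) auto
    finally have "norm g \<le> D * norm d"
      using D(2) by (cases "g = 0") auto
    then have g2: "(norm g)\<^sup>2 \<le> D\<^sup>2 * (norm d)\<^sup>2"
      by (metis norm_ge_zero power_mono power_mult_distrib)
    have "(norm (T u - T v))\<^sup>2 = (norm d)\<^sup>2 - 2 * \<rho> * blinfun_apply (A d) d + \<rho>\<^sup>2 * (norm g)\<^sup>2"
    proof -
      have "g \<bullet> d = blinfun_apply (A d) d"
        by (simp add: g_def R)
      then show ?thesis
        unfolding diff power2_norm_eq_inner
        by (simp add: inner_diff inner_commute power2_eq_square algebra_simps)
    qed
    also have "\<dots> \<le> (norm d)\<^sup>2 - 2 * \<rho> * (\<kappa> * (norm d)\<^sup>2) + \<rho>\<^sup>2 * (D\<^sup>2 * (norm d)\<^sup>2)"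
      using coercive[of d] g2 \<kappa> D(2) by (intro add_mono diff_mono mult_left_mono) (auto simp: \<rho>_def)
    also have "\<dots> = (1 - \<kappa>\<^sup>2 / D\<^sup>2) * (norm d)\<^sup>2"
      using D(2) by (simp add: \<rho>_def field_simps power2_eq_square)
    also have "\<dots> = (c * norm d)\<^sup>2"
      using ratio(2) by (simp add: c_def power_mult_distrib)
    finally have "norm (T u - T v) \<le> c * norm d"
      by (rule power2_le_imp_le) (simp add: c(1))
    then show ?thesis
      by (simp only: dist_norm d_def)
  qed
  have "\<exists>!u. T u = u"
    by (rule banach_fix_type[OF c, of T]) (intro allI contraction)
  then obtain u where "T u = u"
    by blast
  then have "R (A u - F) = 0"
    using \<kappa> D(2) by (simp add: T_def \<rho>_def)
  then have "blinfun_apply (A u - F) v = 0" for v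
    by (metis R inner_zero_left)
  then have "A u = F"
    by (intro blinfun_eqI) (simp add: blinfun.diff_left)
  then show ?thesis ..
qed

section \<open>Existence for the semilinear equation\<close>

lemma compact_operator_imp_bounded_linear:
  assumes "compact_operator T"
  shows "bounded_linear T"
proof -
  have lin: "linear T" and "compact (closure (T ` cball 0 1))"
    using assms bounded_cball by (auto simp: compact_operator_def)
  then have "bounded (T ` cball 0 1)"
    by (meson bounded_subset closure_subset compact_imp_bounded)
  then obtain B where "\<forall>x\<in>cball 0 1. norm (T x) \<le> B"
    by (auto simp: bounded_iff)
  then have B: "norm (T x) \<le> B" if "norm x \<le> 1" for x
    using that by simp
  have "norm (T x) \<le> norm x * B" for x
  proof (cases "x = 0")
    case True
    then show ?thesis
      using linear_0[OF lin] by simp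
  next
    case False
    have "T x = norm x *\<^sub>R T ((1 / norm x) *\<^sub>R x)"
      using False by (simp add: linear_cmul[OF lin])
    then have "norm (T x) = norm x * norm (T ((1 / norm x) *\<^sub>R x))"
      by (metis abs_norm_cancel norm_scaleR)
    also have "\<dots> \<le> norm x * B"
      using False by (intro mult_left_mono B) auto
    finally show ?thesis .
  qed
  with lin show ?thesis
    unfolding linear_conv_bounded_linear bounded_linear_def bounded_linear_axioms_def by blast
qed

text \<open>
  Any nonnegative \<open>x\<close> with \<open>\<beta> + K * g\<^sup>2 * x\<^sup>2 \<le> \<kappa> * x\<close> makes the ball of radius \<open>x\<close> invariant
  under the solution map of the linear problem with frozen nonlinearity.  The factor
  \<open>norm (eB (u - v))\<close> in the bound for \<open>N u - N v\<close> makes this map compact.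
\<close>
lemma semilinear_solution_exists:
  fixes A N :: "'v::{real_inner, complete_space} \<Rightarrow> 'v \<Rightarrow>\<^sub>L real"
    and T :: "'v \<Rightarrow> 'v" and eB :: "'v \<Rightarrow> 'b::real_normed_vector" and b :: "'v \<Rightarrow>\<^sub>L real"
  assumes A: "linear A" "\<And>u v. \<bar>blinfun_apply (A u) v\<bar> \<le> C * norm u * norm v"
      "\<And>u. \<kappa> * (norm u)\<^sup>2 \<le> blinfun_apply (A u) u"
    and T: "linear T" "\<And>u. norm (T u) \<le> g * norm u"
    and b: "\<And>v. \<bar>blinfun_apply b v\<bar> \<le> \<beta> * norm v"
    and N: "\<And>u w. \<bar>blinfun_apply (N u) w\<bar> \<le> K * (norm u)\<^sup>2 * norm w"
    and N_lip: "\<And>u v w. \<bar>blinfun_apply (N u - N v) w\<bar> \<le> M * (norm u + norm v) * norm (eB (u - v)) * norm (eB w)"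
    and eB: "compact_operator eB"
    and pos: "0 < \<kappa>" "0 \<le> K" "0 \<le> M" "0 \<le> g" "0 \<le> x"
    and ball: "\<beta> + K * g\<^sup>2 * x\<^sup>2 \<le> \<kappa> * x"
  shows "\<exists>w. A w = - b - N (T w) \<and> norm w \<le> x"
proof -
  have "\<exists>F. \<forall>u. A (F u) = - b - N (T u)"
    by (rule choice) (intro allI lax_milgram[OF A pos(1)])
  then obtain F where F: "\<And>u. A (F u) = - b - N (T u)"
    by blast
  have bl_eB: "bounded_linear eB"
    using eB by (rule compact_operator_imp_bounded_linear)
  then have lin_eB: "linear eB"
    by (rule bounded_linear.linear)
  obtain B where B: "0 < B" "\<And>v. norm (eB v) \<le> norm v * B"
    using bounded_linear.pos_bounded[OF bl_eB] by blast
  have T_ball: "norm (T u) \<le> g * x" if "norm u \<le> x" for u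
    using T(2)[of u] mult_left_mono[OF that pos(4)] by linarith

  have self: "norm (F u) \<le> x" if u: "norm u \<le> x" for u
  proof -
    define w where "w = F u"
    have "\<kappa> * (norm w)\<^sup>2 \<le> - blinfun_apply b w - blinfun_apply (N (T u)) w"
      using A(3)[of w] by (simp add: w_def F blinfun.diff_left blinfun.minus_left)
    also have "\<dots> \<le> \<beta> * norm w + K * (norm (T u))\<^sup>2 * norm w"
      using b[of w] N[of "T u" w] by linarith
    also have "\<dots> \<le> \<beta> * norm w + K * (g * x)\<^sup>2 * norm w"
      using T_ball[OF u] pos by (intro add_left_mono mult_right_mono mult_left_mono power_mono) auto
    also have "\<dots> = (\<beta> + K * g\<^sup>2 * x\<^sup>2) * norm w"
      by (simp add: algebra_simps power_mult_distrib)
    also have "\<dots> \<le> \<kappa> * x * norm w"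
      using ball by (intro mult_right_mono) auto
    finally have "\<kappa> * norm w * norm w \<le> \<kappa> * x * norm w"
      by (simp add: power2_eq_square mult.assoc)
    then show ?thesis
      using pos by (cases "w = 0") (auto simp: w_def)
  qed

  \<comment> \<open>Both the continuity of \<open>F\<close> and the compactness of its image come from this bound: one factor
    \<open>norm d\<close> is cancelled, while the difference of the arguments is kept in the norm after \<open>eB\<close>.\<close>
  define D where "D = M * (2 * g * x) * B / \<kappa>"
  have lip: "dist (F u) (F v) \<le> D * dist (eB (T u)) (eB (T v))"
    if u: "norm u \<le> x" and v: "norm v \<le> x" for u v
  proof -
    define d where "d = F u - F v"
    define \<tau> where "\<tau> = norm (eB (T u - T v))"
    have "A d = N (T v) - N (T u)"
      by (simp add: d_def linear_diff[OF A(1)] F)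
    then have "\<kappa> * (norm d)\<^sup>2 \<le> \<bar>blinfun_apply (N (T u) - N (T v)) d\<bar>"
      using A(3)[of d] by (simp add: blinfun.diff_left)
    also have "\<dots> \<le> M * (norm (T u) + norm (T v)) * \<tau> * norm (eB d)"
      unfolding \<tau>_def by (rule N_lip)
    also have "\<dots> \<le> M * (2 * g * x) * \<tau> * (norm d * B)"
      using T_ball[OF u] T_ball[OF v] B(2)[of d] pos
      by (intro mult_mono) (auto simp: \<tau>_def)
    finally have "\<kappa> * norm d * norm d \<le> M * (2 * g * x) * B * \<tau> * norm d"
      by (simp add: power2_eq_square mult_ac)
    moreover have "0 \<le> M * (2 * g * x) * B * \<tau>"
      using pos B(1) by (simp add: \<tau>_def)
    ultimately have "\<kappa> * norm d \<le> M * (2 * g * x) * B * \<tau>"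
      by (cases "d = 0") auto
    then have "norm d \<le> D * \<tau>"
      using pos(1) by (simp add: D_def field_simps)
    then show ?thesis
      by (simp add: d_def \<tau>_def dist_norm linear_diff[OF lin_eB])
  qed

  have "bounded_linear T"
    using T by (intro bounded_linear_intro[of T g]) (auto simp: linear_add linear_cmul mult.commute)
  then have "continuous_on UNIV (\<lambda>u. eB (T u))"
    by (intro linear_continuous_on bounded_linear_compose[OF bl_eB])
  then have eBT: "continuous_on (cball 0 x) (\<lambda>u. eB (T u))"
    by (rule continuous_on_subset) simp
  have cont: "continuous_on (cball 0 x) F"
  proof -
    have "(F \<longlongrightarrow> F u) (at u within cball 0 x)" if u: "u \<in> cball 0 x" for u
    proof -
      have "((\<lambda>v. D * dist (eB (T v)) (eB (T u))) \<longlongrightarrow> D * dist (eB (T u)) (eB (T u))) (at u within cball 0 x)"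
        using eBT u by (intro tendsto_intros) (simp add: continuous_on_def)
      then have "((\<lambda>v. D * dist (eB (T v)) (eB (T u))) \<longlongrightarrow> 0) (at u within cball 0 x)"
        by simp
      moreover have "\<forall>\<^sub>F v in at u within cball 0 x. norm (dist (F v) (F u)) \<le> D * dist (eB (T v)) (eB (T u))"
        unfolding eventually_at_filter using lip u by (intro always_eventually) simp
      ultimately have "((\<lambda>v. dist (F v) (F u)) \<longlongrightarrow> 0) (at u within cball 0 x)"
        by (rule Lim_null_comparison[rotated])
      then show ?thesis
        by (rule tendsto_dist_iff[THEN iffD2])
    qed
    then show ?thesis
      by (simp add: continuous_on_def)
  qed
  have "bounded (T ` cball 0 x)"
    by (simp add: \<open>bounded_linear T\<close> bounded_linear_image)
  then have "compact (closure ((\<lambda>u. eB (T u)) ` cball 0 x))"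
    using eB by (simp add: compact_operator_def image_image[of eB T, symmetric])
  then have comp: "compact (closure (F ` cball 0 x))"
    by (rule compact_closure_image_via_lipschitz_factor) (auto intro: lip)
  obtain w where "w \<in> cball 0 x" "F w = w"
    by (rule schauder_fixed_point[OF _ _ _ cont _ comp]) (use self pos in auto)
  then show ?thesis
    using F[of w] by auto
qed

section \<open>The finite-rank correction\<close>

lemma norm_sum_scaleR_le_L2_set:
  fixes x :: "'i \<Rightarrow> 'a::real_normed_vector"
  shows "norm (\<Sum>j\<in>A. c j *\<^sub>R x j) \<le> L2_set c A * L2_set (\<lambda>j. norm (x j)) A"
proof -
  have "norm (\<Sum>j\<in>A. c j *\<^sub>R x j) \<le> (\<Sum>j\<in>A. \<bar>c j\<bar> * \<bar>norm (x j)\<bar>)"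
    by (rule sum_norm_le) simp
  also have "\<dots> \<le> L2_set c A * L2_set (\<lambda>j. norm (x j)) A"
    by (rule L2_set_mult_ineq)
  finally show ?thesis .
qed

text \<open>
  Coordinates with respect to independent vectors are unique, so they inherit linearity from
  the vector that they represent.
\<close>
lemma linear_coordinates:
  fixes I :: "'v::real_vector \<Rightarrow> 'h::real_vector"
  assumes lin: "linear I" and coords: "\<And>f. I f = (\<Sum>j\<in>A. s j f *\<^sub>R \<psi> j)"
    and A: "finite A" and basis: "inj_on \<psi> A" "independent (\<psi> ` A)" and j: "j \<in> A"
  shows "linear (s j)"
proof -
  have unique: "c j = 0" if "(\<Sum>j\<in>A. c j *\<^sub>R \<psi> j) = 0" for c
  proof -
    have "(\<Sum>v\<in>\<psi> ` A. c (inv_into A \<psi> v) *\<^sub>R v) = 0"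
      using that basis(1) by (simp add: sum.reindex)
    then show ?thesis
      using independentD[OF basis(2) _ _ _, of "\<psi> ` A" "\<lambda>v. c (inv_into A \<psi> v)" "\<psi> j"] A j basis(1)
      by simp
  qed
  show ?thesis
  proof (rule linearI)
    fix f g
    have "(\<Sum>j\<in>A. (s j (f + g) - (s j f + s j g)) *\<^sub>R \<psi> j) = I (f + g) - (I f + I g)"
      by (simp add: coords scaleR_diff_left scaleR_add_left sum_subtractf sum.distrib)
    then have "(\<Sum>j\<in>A. (s j (f + g) - (s j f + s j g)) *\<^sub>R \<psi> j) = 0"
      by (simp add: linear_add[OF lin])
    from unique[OF this] show "s j (f + g) = s j f + s j g"
      by simp
  next
    fix r f
    have "(\<Sum>j\<in>A. (s j (r *\<^sub>R f) - r * s j f) *\<^sub>R \<psi> j) = I (r *\<^sub>R f) - r *\<^sub>R I f"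
      by (simp add: coords scaleR_diff_left sum_subtractf scaleR_sum_right)
    then have "(\<Sum>j\<in>A. (s j (r *\<^sub>R f) - r * s j f) *\<^sub>R \<psi> j) = 0"
      by (simp add: linear_cmul[OF lin])
    from unique[OF this] show "s j (r *\<^sub>R f) = r *\<^sub>R s j f"
      by simp
  qed
qed

lemma linear_dual_of:
  assumes "bounded_linear e"
  shows "linear (dual_of e)"
  by (rule linearI) (auto intro!: blinfun_eqI
    simp: dual_of_apply[OF assms] blinfun.add_left blinfun.scaleR_left inner_add_left)

lemma linear_L_full:
  assumes "bounded_linear e" "linear L1" "linear L2"
  shows "linear (L_full e L1 L2)"
proof -
  note lin = linear_dual_of[OF assms(1)] assms(2,3) bounded_linear.linear[OF assms(1)]
  show ?thesis
    unfolding L_full_def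
    by (rule linearI) (simp_all add: lin[THEN linear_add] lin[THEN linear_cmul] scaleR_add_right)
qed

text \<open>
  The radius for which the estimate of the solution map closes up with equality; the condition
  on the discriminant is what makes this radius real.
\<close>
lemma smaller_root:
  fixes a k c :: real
  assumes "0 < a" "0 \<le> c" "0 < k" and disc: "0 \<le> k\<^sup>2 - 4 * a * c"
  defines "x \<equiv> (k - sqrt (k\<^sup>2 - 4 * a * c)) / (2 * a)"
  shows "0 \<le> x" and "c + a * x\<^sup>2 = k * x"
proof -
  define S where "S = sqrt (k\<^sup>2 - 4 * a * c)"
  have "S \<le> k"
    using assms(1-3) by (auto simp: S_def intro!: real_le_lsqrt)
  then show "0 \<le> x"
    using assms(1) by (simp add: x_def S_def)
  have S2: "S\<^sup>2 = k\<^sup>2 - 4 * a * c"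
    using disc by (simp add: S_def)
  have S: "S = k - 2 * a * x"
    using assms(1) by (simp add: x_def S_def)
  have "4 * a * (c + a * x\<^sup>2) = 4 * a * (k * x)"
    using S2 unfolding S by (simp add: power2_diff power2_eq_square algebra_simps)
  then show "c + a * x\<^sup>2 = k * x"
    using assms(1) by simp
qed

theorem theorem3:
  fixes eB :: "'v::{real_inner, complete_space} \<Rightarrow> 'b::banach"
    and eB0 :: "'b \<Rightarrow> 'h::{real_inner, complete_space}"
    and e :: "'v \<Rightarrow> 'h"
    and L1 :: "'v \<Rightarrow> 'v dual"
    and L2 :: "'h \<Rightarrow> 'h"
    and N :: "'v \<Rightarrow> 'v dual"
    and E :: 'h
    and J :: "'h \<Rightarrow> 'v dual"
    and wbar :: 'h
    and n :: nat
    and I :: "'v \<Rightarrow> 'h"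
    and s :: "nat \<Rightarrow> 'v \<Rightarrow> real"
    and \<psi> r :: "nat \<Rightarrow> 'h"
    and \<phi> :: "nat \<Rightarrow> 'v"
    and K0 K1 K2 K3 \<delta>1 \<gamma>1 \<gamma>2 \<epsilon>1 \<epsilon>2 \<kappa> M4 xw :: real
  assumes e_eq: "e = eB0 \<circ> eB"
    and B_dense: "dense_embedding eB0"
    and H1_dense: "dense_embedding e"
    and compact_emb: "compact_operator eB"
    and consts_pos: "K0 > 0" "K1 > 0" "K2 > 0" "K3 > 0"
    and K0: "\<And>f. norm (e f) \<le> K0 * norm f"
    and H0_B: "\<exists>C>0. \<forall>f. norm (e f) \<le> C * norm (eB f)"
    and L1_linear: "linear L1"
    and L1_coercive: "\<And>f. blinfun_apply (L1 f) f \<ge> K1 * (norm f)\<^sup>2"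
    and L1_bounded: "\<exists>C>0. \<forall>f g. \<bar>blinfun_apply (L1 f) g\<bar> \<le> C * norm f * norm g"
    and L2_linear: "linear L2"
    and L2_bounded: "\<And>f. norm (L2 f) \<le> K2 * norm f"
    and I_linear: "linear I"
    and I_approx: "\<And>f. norm (e f - I f) \<le> \<delta>1 * norm f"
    and \<psi>_basis: "inj_on \<psi> {1..n}" "independent (\<psi> ` {1..n})" "span (\<psi> ` {1..n}) = range I"
    and I_coords: "\<And>f. I f = (\<Sum>j=1..n. s j f *\<^sub>R \<psi> j)"
    and \<phi>_eq: "\<And>i. i \<in> {1..n} \<Longrightarrow> L_full e L1 L2 (\<phi> i) = dual_of e (- L2 (\<psi> i) + r i)"
    and R_bound: "L2_set (\<lambda>j. norm (r j)) {1..n} \<le> \<epsilon>1"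
    and S_H0: "\<exists>C>0. \<forall>f. L2_set (\<lambda>j. s j f) {1..n} \<le> C * norm (e f)"
    and \<gamma>1_nonneg: "\<gamma>1 \<ge> 0"
    and S_H1: "\<And>f. L2_set (\<lambda>j. s j f) {1..n} \<le> \<gamma>1 * norm f"
    and \<Phi>_bound: "L2_set (\<lambda>j. norm (\<phi> j)) {1..n} \<le> \<gamma>2"
    and E_bound: "norm E \<le> \<epsilon>2"
    and N_bound: "\<And>u w. \<bar>blinfun_apply (N u) w\<bar> \<le> K3 * (norm u)\<^sup>2 * norm w"
    and N_lipschitz: "\<exists>C>0. \<forall>u1 u2 w1 w2.
          \<bar>blinfun_apply (N u1 - N u2) (w1 - w2)\<bar>
            \<le> C * (norm u1 + norm u2) * norm (eB (u1 - u2)) * norm (eB (w1 - w2))"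
    and J_wbar: "J wbar = dual_of e E"
    and J_expansion: "\<And>w. J (wbar + e w) = L_full e L1 L2 w + N w + dual_of e E"
    and \<kappa>_eq: "\<kappa> = K1 - K0 * K2 * \<delta>1 - K0 * \<gamma>1 * \<epsilon>1"
    and \<kappa>_pos: "\<kappa> > 0"
    and M4_eq: "M4 = \<kappa>\<^sup>2 - 4 * \<epsilon>2 * K0 * K3 * (1 + \<gamma>1 * \<gamma>2)\<^sup>2"
    and M4_nonneg: "M4 \<ge> 0"
    and xw_eq: "xw = (\<kappa> - sqrt M4) / (2 * K3 * (1 + \<gamma>1 * \<gamma>2)\<^sup>2)"
  shows "(\<exists>w1 w2.
            L1 w1 + dual_of e (L_res e n L2 s \<psi> r w1) = - dual_of e E - N (w1 + w2)
          \<and> L_full e L1 L2 w2 = - dual_of e (L_ap n L2 s \<psi> r w1)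
          \<and> w2 = G_op n s \<phi> w1
          \<and> norm w1 \<le> xw)
       \<and> (\<exists>wtilde d. J wtilde = 0 \<and> wbar - wtilde = e d \<and> norm d \<le> (1 + \<gamma>1 * \<gamma>2) * xw)"
proof -
  define S where "S w = L2_set (\<lambda>j. s j w) {1..n}" for w
  define g where "g = 1 + \<gamma>1 * \<gamma>2"
  have bl_e: "bounded_linear e"
    using H1_dense by (simp add: dense_embedding_def)
  note dual_lin = linear_dual_of[OF bl_e]
  note L_lin = linear_L_full[OF bl_e L1_linear L2_linear]
  have s_lin: "linear (s j)" if "j \<in> {1..n}" for j
    by (rule linear_coordinates[OF I_linear I_coords _ \<psi>_basis(1,2) that]) simp
  have lin_comb: "linear (\<lambda>w. \<Sum>j=1..n. s j w *\<^sub>R y j)" for y :: "nat \<Rightarrow> 'c::real_vector"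
    by (intro linear_compose_sum ballI linearI)
      (simp_all add: s_lin[THEN linear_add] s_lin[THEN linear_cmul] scaleR_add_left)
  have \<gamma>2_nonneg: "0 \<le> \<gamma>2"
    using \<Phi>_bound L2_set_nonneg order_trans by blast
  have g: "1 \<le> g"
    using \<gamma>1_nonneg \<gamma>2_nonneg by (simp add: g_def)

  have G_lin: "linear (G_op n s \<phi>)"
    unfolding G_op_def by (rule lin_comb)
  have G_bound: "norm (G_op n s \<phi> w) \<le> \<gamma>1 * \<gamma>2 * norm w" for w
  proof -
    have "norm (G_op n s \<phi> w) \<le> S w * L2_set (\<lambda>j. norm (\<phi> j)) {1..n}"
      unfolding G_op_def S_def by (rule norm_sum_scaleR_le_L2_set)
    also have "\<dots> \<le> (\<gamma>1 * norm w) * \<gamma>2"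
      using S_H1[of w] \<Phi>_bound \<gamma>1_nonneg by (intro mult_mono) (auto simp: S_def)
    finally show ?thesis
      by (simp add: mult_ac)
  qed
  define T where "T w = w + G_op n s \<phi> w" for w
  have T_lin: "linear T"
    unfolding T_def using linear_compose_add[OF linear_id G_lin] by (simp add: id_def)
  have T_bound: "norm (T w) \<le> g * norm w" for w
    using norm_triangle_ineq[of w "G_op n s \<phi> w"] G_bound[of w] by (simp add: T_def g_def algebra_simps)

  \<comment> \<open>The second equation of the system, which the construction of \<open>G\<close> builds in.\<close>
  have L_G: "L_full e L1 L2 (G_op n s \<phi> w) = - dual_of e (L_ap n L2 s \<psi> r w)" for w
  proof -
    have "L_full e L1 L2 (G_op n s \<phi> w) = (\<Sum>j=1..n. s j w *\<^sub>R L_full e L1 L2 (\<phi> j))"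
      unfolding G_op_def by (simp add: linear_sum[OF L_lin] linear_cmul[OF L_lin])
    also have "\<dots> = (\<Sum>j=1..n. s j w *\<^sub>R dual_of e (- L2 (\<psi> j) + r j))"
      by (intro sum.cong refl) (simp add: \<phi>_eq)
    also have "\<dots> = dual_of e (\<Sum>j=1..n. s j w *\<^sub>R (- L2 (\<psi> j) + r j))"
      by (simp add: linear_sum[OF dual_lin] linear_cmul[OF dual_lin])
    also have "(\<Sum>j=1..n. s j w *\<^sub>R (- L2 (\<psi> j) + r j)) = - L_ap n L2 s \<psi> r w"
      by (simp add: L_ap_def sum_negf[symmetric] scaleR_minus_right[symmetric] del: scaleR_minus_right sum_negf)
    finally show ?thesis
      by (simp add: linear_neg[OF dual_lin])
  qed

  have res_lin: "linear (L_res e n L2 s \<psi> r)"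
    unfolding L_res_def L_ap_def
    by (intro linear_compose_sub lin_comb linear_compose[OF bounded_linear.linear[OF bl_e] L2_linear, unfolded o_def])
  have res_bound: "norm (L_res e n L2 s \<psi> r w) \<le> (K2 * \<delta>1 + \<gamma>1 * \<epsilon>1) * norm w" for w
  proof -
    have "norm (L2 (e w - I w)) \<le> K2 * (\<delta>1 * norm w)"
      using L2_bounded[of "e w - I w"] mult_left_mono[OF I_approx[of w], of K2] consts_pos by linarith
    moreover have "norm (\<Sum>j=1..n. s j w *\<^sub>R r j) \<le> (\<gamma>1 * norm w) * \<epsilon>1"
    proof -
      have "norm (\<Sum>j=1..n. s j w *\<^sub>R r j) \<le> S w * L2_set (\<lambda>j. norm (r j)) {1..n}"
        unfolding S_def by (rule norm_sum_scaleR_le_L2_set)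
      also have "\<dots> \<le> (\<gamma>1 * norm w) * \<epsilon>1"
        using S_H1[of w] R_bound \<gamma>1_nonneg by (intro mult_mono) (auto simp: S_def)
      finally show ?thesis .
    qed
    ultimately have "norm (L2 (e w - I w) + (\<Sum>j=1..n. s j w *\<^sub>R r j)) \<le> K2 * (\<delta>1 * norm w) + \<gamma>1 * norm w * \<epsilon>1"
      by (rule norm_triangle_mono)
    also have "\<dots> = (K2 * \<delta>1 + \<gamma>1 * \<epsilon>1) * norm w"
      by (simp add: algebra_simps)
    finally show ?thesis
      unfolding L_res_alt[where I = I and s = s and \<psi> = \<psi>, OF L2_linear I_coords] .
  qed
  have pair_bound: "\<bar>h \<bullet> e v\<bar> \<le> norm h * (K0 * norm v)" for h v
    using Cauchy_Schwarz_ineq2[of h "e v"] mult_left_mono[OF K0[of v] norm_ge_zero[of h]] by linarith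

  define A where "A w = L1 w + dual_of e (L_res e n L2 s \<psi> r w)" for w
  have A_apply: "blinfun_apply (A w) v = blinfun_apply (L1 w) v + L_res e n L2 s \<psi> r w \<bullet> e v" for w v
    by (simp add: A_def blinfun.add_left dual_of_apply[OF bl_e])
  define P where "P = K2 * \<delta>1 + \<gamma>1 * \<epsilon>1"
  have res_pair: "\<bar>L_res e n L2 s \<psi> r w \<bullet> e v\<bar> \<le> K0 * P * norm w * norm v" for w v
  proof -
    have "\<bar>L_res e n L2 s \<psi> r w \<bullet> e v\<bar> \<le> (P * norm w) * (K0 * norm v)"
      by (rule order_trans[OF pair_bound mult_right_mono[OF res_bound[folded P_def]]]) (use consts_pos in simp)
    then show ?thesis
      by (simp add: mult_ac)
  qed
  obtain C1 where C1: "\<And>f g. \<bar>blinfun_apply (L1 f) g\<bar> \<le> C1 * norm f * norm g"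
    using L1_bounded by blast
  obtain M where M: "0 < M" "\<And>u1 u2 w1 w2. \<bar>blinfun_apply (N u1 - N u2) (w1 - w2)\<bar>
      \<le> M * (norm u1 + norm u2) * norm (eB (u1 - u2)) * norm (eB (w1 - w2))"
    using N_lipschitz by blast
  have a: "0 < K3 * g\<^sup>2" and c: "0 \<le> K0 * \<epsilon>2"
    using consts_pos g order_trans[OF norm_ge_zero E_bound] by simp_all
  have M4: "M4 = \<kappa>\<^sup>2 - 4 * (K3 * g\<^sup>2) * (K0 * \<epsilon>2)"
    by (simp add: M4_eq g_def mult_ac)
  have xw: "xw = (\<kappa> - sqrt (\<kappa>\<^sup>2 - 4 * (K3 * g\<^sup>2) * (K0 * \<epsilon>2))) / (2 * (K3 * g\<^sup>2))"
    unfolding M4[symmetric] by (simp add: xw_eq g_def mult_ac)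
  note root = smaller_root[OF a c \<kappa>_pos M4_nonneg[unfolded M4], folded xw]

  have "\<exists>w. A w = - dual_of e E - N (T w) \<and> norm w \<le> xw"
  proof (rule semilinear_solution_exists)
    show "linear A"
      unfolding A_def
      by (intro linear_compose_add L1_linear linear_compose[OF res_lin dual_lin, unfolded o_def])
    show "\<bar>blinfun_apply (A u) v\<bar> \<le> (C1 + K0 * P) * norm u * norm v" for u v
      using C1[of u v] res_pair[of u v] by (simp add: A_apply algebra_simps)
    show "\<kappa> * (norm u)\<^sup>2 \<le> blinfun_apply (A u) u" for u
      using L1_coercive[of u] res_pair[of u u]
      by (simp add: A_apply \<kappa>_eq P_def power2_eq_square algebra_simps)
    show "\<bar>blinfun_apply (dual_of e E) v\<bar> \<le> (K0 * \<epsilon>2) * norm v" for v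
    proof -
      have "\<bar>E \<bullet> e v\<bar> \<le> \<epsilon>2 * (K0 * norm v)"
        by (rule order_trans[OF pair_bound mult_right_mono[OF E_bound]]) (use consts_pos in simp)
      then show ?thesis
        by (simp add: dual_of_apply[OF bl_e] mult_ac)
    qed
    show "\<bar>blinfun_apply (N u - N v) w\<bar> \<le> M * (norm u + norm v) * norm (eB (u - v)) * norm (eB w)" for u v w
      using M(2)[of u v w 0] by simp
    show "K0 * \<epsilon>2 + K3 * g\<^sup>2 * xw\<^sup>2 \<le> \<kappa> * xw"
      using root(2) by simp
  qed (use T_lin T_bound N_bound compact_emb \<kappa>_pos consts_pos M g root(1) in auto)
  then obtain w where w: "A w = - dual_of e E - N (T w)" "norm w \<le> xw"
    by blast

  \<comment> \<open>The two occurrences of \<open>L_ap\<close> cancel: one is subtracted in \<open>L_res\<close>, the other comes from \<open>G\<close>.\<close>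
  have "L_full e L1 L2 (T w) = A w"
  proof -
    have "L_full e L1 L2 w = A w + dual_of e (L_ap n L2 s \<psi> r w)"
      by (simp add: L_full_def A_def L_res_def linear_diff[OF dual_lin])
    then show ?thesis
      by (simp add: T_def linear_add[OF L_lin] L_G)
  qed
  then have "J (wbar + e (T w)) = 0"
    by (simp add: J_expansion w(1))
  moreover have "wbar - (wbar + e (T w)) = e (- T w)"
    by (simp add: linear_neg[OF bounded_linear.linear[OF bl_e]])
  moreover have "norm (- T w) \<le> (1 + \<gamma>1 * \<gamma>2) * xw"
    using order_trans[OF T_bound mult_left_mono[OF w(2)]] g by (simp add: g_def)
  ultimately show ?thesis
    using w L_G[of w] unfolding A_def T_def by blast
qed

end
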